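(* Let $\mathbf{x}=(x_1,\dots,x_n)$ be an ordered $n$-tuple in $[0,1)$, i.e. $0\le x_1<x_2<\dots<x_n<1$, and let $\boldsymbol{\alpha}=(\alpha_1,\dots,\alpha_n)\in\{0,1,\dots,d^2-1\}^{n}$. Let $P$ be the minimal supporting partition of $\mathbf{x}$. Then the limit $$C^{\alpha_1\alpha_2\cdots\alpha_n}(x_1,x_2,\dots,x_n)=\lim_{P\le Q}\langle\Omega_Q,M^{\boldsymbol{\alpha}}_Q(\mathbf{x})\,\Omega_Q\rangle$$ of the net indexed by the standard dyadic partitions $Q$ refining $P$ exists and is equal to $\langle\Omega_P,M^{\boldsymbol{\alpha}}_P(\mathbf{x})\,\Omega_P\rangle$.
   Context: Partitions: $D([0,1])$ is the set of standard dyadic partitions of $[0,1)$, i.e. finite partitions into standard dyadic intervals $[\frac{a}{2^k},\frac{a+1}{2^k})$, directed by refinement ($P\le Q$ means $Q$ refines $P$). $P$ supports $\mathbf{x}$ if every $I\in P$ contains at most one entry of $\mathbf{x}$; it is a minimal supporting partition if no strictly coarser partition in $D([0,1])$ supports $\mathbf{x}$ (it is unique). Tensor data: $V\colon\mathbb{C}^d\to\mathbb{C}^d\otimes\mathbb{C}^d$ is an isometry with $\mathrm{swap}\circ V=V$, where $\mathrm{swap}(\phi\otimes\psi)=\psi\otimes\phi$. The map $E\colon M_d(\mathbb{C})\to M_d(\mathbb{C})$, $E(A)=V^\dagger(A\otimes\mathbf{1})V$, is assumed diagonalizable with eigenbasis $E(\mu^\alpha)=\lambda_\alpha\mu^\alpha$,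 $\alpha=0,\dots,d^2-1$, where $\mu^0=\mathbf{1}$, $\lambda_0=1$, and all $\lambda_\alpha\ne0$. Hilbert spaces: $\mathfrak{H}_P=(\mathbb{C}^d)^{\otimes|P|}$, one factor per interval of $P$. For $P\le Q$, $\Psi^P_Q\colon\mathfrak{H}_P\to\mathfrak{H}_Q$ is the isometry obtained by applying $V$ once for each halving of an interval needed to pass from $P$ to $Q$ (left half to the first factor, right half to the second). $\mathfrak{H}$ is the direct limit. The vacuum vector $\Omega\in\mathfrak{H}$ is represented by a unit vector $\Omega_{[0,1]}\in\mathbb{C}^d$, and $\Omega_P=\Psi^{\{[0,1)\}}_P\Omega_{[0,1]}$ is its representative on $P$, so $\Omega_Q=\Psi^P_Q\Omega_P$. Fields: $\mu^\alpha_I$ is $\mu^\alpha$ acting on the tensor factor of $I\in Q$ (identity elsewhere). $\phi^\alpha_Q(z)=\sum_{I\in Q}\chi_I(z)\,(\lambda_\alpha)^{\log_2|I|}\,\mu^\alpha_I$, where $\chi_I$ is the indicator function and $|I|$ the length of $I$. For $Q\ge P$, $M^{\boldsymbol{\alpha}}_Q(\mathbf{x})=\prod_{j=1}^n\phi_Q^{\alpha_j}(x_j)$ (the factors commute). *)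

theory Defs
  imports "HOL-Analysis.Analysis"
begin

section \<open>Standard dyadic partitions\<close>

definition dyadic :: "nat \<Rightarrow> nat \<Rightarrow> real set" where
  "dyadic k a = {real a / 2 ^ k ..< (real a + 1) / 2 ^ k}"

definition dyadic_partitions :: "real set set set" where
  "dyadic_partitions =
     {P. finite P \<and> partition_on {0..<1} P \<and> (\<forall>I\<in>P. \<exists>k a. I = dyadic k a)}"

text \<open>
  The order \<open>P \<le> Q\<close> is \<open>refines {0..<1} Q P\<close>, which says that \<open>Q\<close> is finer than or equal to \<open>P\<close>.
\<close>

definition supports :: "real set set \<Rightarrow> real list \<Rightarrow> bool" where
  "supports P xs \<longleftrightarrow> (\<forall>I\<in>P. card {j. j < length xs \<and> xs ! j \<in> I} \<le> 1)"

definition minimal_supporting :: "real set set \<Rightarrow> real list \<Rightarrow> bool" where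
  "minimal_supporting P xs \<longleftrightarrow>
     P \<in> dyadic_partitions \<and> supports P xs \<and>
     \<not> (\<exists>P'\<in>dyadic_partitions. P' \<noteq> P \<and> refines {0..<1} P P' \<and> supports P' xs)"

text \<open>
  The filter of tails of the directed set of standard dyadic partitions refining \<open>P\<close>. Convergence
  along it is convergence of nets; see \<open>eventually_refinement_net\<close> below.
\<close>

definition refinement_net :: "real set set \<Rightarrow> real set set filter" where
  "refinement_net P =
     (INF Q0 \<in> {Q \<in> dyadic_partitions. refines {0..<1} Q P}.
        principal {Q \<in> dyadic_partitions. refines {0..<1} Q Q0})"


section \<open>Tensor data\<close>

text \<open>
  \<open>\<complex>\<^sup>d\<close> is \<open>complex ^ 'n\<close> with \<open>d = CARD('n)\<close>, and \<open>\<complex>\<^sup>d \<otimes> \<complex>\<^sup>d\<close> is \<open>complex ^ ('n \<times> 'n)\<close>, the basis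
  vector with index \<open>(i, j)\<close> being \<open>e\<^sub>i \<otimes> e\<^sub>j\<close>. Linear maps are given by their matrices.
\<close>

definition adjoint_matrix :: "complex ^ 'n ^ 'm \<Rightarrow> complex ^ 'm ^ 'n" where
  "adjoint_matrix A = (\<chi> i j. cnj (A $ j $ i))"

definition tensor_vec :: "complex ^ 'n::finite \<Rightarrow> complex ^ 'm::finite \<Rightarrow> complex ^ ('n \<times> 'm)" where
  "tensor_vec v w = (\<chi> p. v $ fst p * w $ snd p)"

definition tensor_mat ::
  "complex ^ 'n::finite ^ 'n \<Rightarrow> complex ^ 'm::finite ^ 'm \<Rightarrow> complex ^ ('n \<times> 'm) ^ ('n \<times> 'm)" where
  "tensor_mat A B = (\<chi> p q. A $ fst p $ fst q * B $ snd p $ snd q)"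

definition swap_vec :: "complex ^ ('n::finite \<times> 'm::finite) \<Rightarrow> complex ^ ('m \<times> 'n)" where
  "swap_vec w = (\<chi> p. w $ (snd p, fst p))"

lemma swap_vec_tensor_vec: "swap_vec (tensor_vec v w) = tensor_vec w v"
  by (simp add: swap_vec_def tensor_vec_def vec_eq_iff)

lemma tensor_mat_tensor_vec:
  fixes A :: "complex ^ 'n::finite ^ 'n" and B :: "complex ^ 'm::finite ^ 'm"
  shows "tensor_mat A B *v tensor_vec v w = tensor_vec (A *v v) (B *v w)"
proof -
  have "(\<Sum>q\<in>UNIV. (A $ i $ fst q * B $ j $ snd q) * (v $ fst q * w $ snd q)) =
      (\<Sum>k\<in>UNIV. A $ i $ k * v $ k) * (\<Sum>l\<in>UNIV. B $ j $ l * w $ l)" for i j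
    unfolding sum_product UNIV_Times_UNIV[symmetric]
    by (subst sum.cartesian_product) (simp add: case_prod_beta mult_ac)
  then show ?thesis
    by (simp add: tensor_mat_def tensor_vec_def matrix_vector_mult_def vec_eq_iff)
qed

definition isometry_mat :: "complex ^ 'n::finite ^ 'm::finite \<Rightarrow> bool" where
  "isometry_mat V \<longleftrightarrow> (\<forall>v. norm (V *v v) = norm v)"

definition E_map :: "complex ^ 'n::finite ^ ('n \<times> 'n) \<Rightarrow> complex ^ 'n ^ 'n \<Rightarrow> complex ^ 'n ^ 'n" where
  "E_map V A = adjoint_matrix V ** tensor_mat A (mat 1) ** V"

definition mat_scale :: "complex \<Rightarrow> complex ^ 'n ^ 'm \<Rightarrow> complex ^ 'n ^ 'm" where
  "mat_scale c A = (\<chi> i j. c * A $ i $ j)"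

interpretation cmat: vector_space "mat_scale :: complex \<Rightarrow> complex ^ 'n ^ 'm \<Rightarrow> _"
  by unfold_locales (auto simp: mat_scale_def vec_eq_iff algebra_simps)

definition eigenbasis ::
  "complex ^ 'n::finite ^ ('n \<times> 'n) \<Rightarrow> (nat \<Rightarrow> complex) \<Rightarrow> (nat \<Rightarrow> complex ^ 'n ^ 'n) \<Rightarrow> bool" where
  "eigenbasis V lam mu \<longleftrightarrow>
     inj_on mu {..<CARD('n)\<^sup>2} \<and>
     cmat.independent (mu ` {..<CARD('n)\<^sup>2}) \<and>
     cmat.span (mu ` {..<CARD('n)\<^sup>2}) = UNIV \<and>
     (\<forall>\<alpha> < CARD('n)\<^sup>2. E_map V (mu \<alpha>) = mat_scale (lam \<alpha>) (mu \<alpha>))"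


section \<open>The spaces attached to partitions\<close>

text \<open>
  The tensor product of copies of \<open>\<complex>\<^sup>d\<close> indexed by \<open>P\<close> is realised as the space of functions of
  labellings \<open>s\<close> of the intervals by basis indices, where only the labels of the intervals in \<open>P\<close>
  matter: \<open>\<psi> s\<close> is the coordinate of \<open>\<psi>\<close> at the product basis vector having \<open>e\<^sub>i\<close> with \<open>i = s I\<close> in
  the factor of each \<open>I \<in> P\<close>. Labels are defined on all sets, but the inner product sums over labellings of \<open>P\<close> only.
\<close>

type_synonym 'n state = "(real set \<Rightarrow> 'n) \<Rightarrow> complex"

definition tensor_space :: "real set set \<Rightarrow> 'n state set" where
  "tensor_space P = {\<psi>. \<forall>s t. (\<forall>I\<in>P. s I = t I) \<longrightarrow> \<psi> s = \<psi> t}"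

definition tensor_inner :: "real set set \<Rightarrow> 'n state \<Rightarrow> 'n state \<Rightarrow> complex" where
  "tensor_inner P \<phi> \<psi> = (\<Sum>s \<in> P \<rightarrow>\<^sub>E UNIV. cnj (\<phi> s) * \<psi> s)"

definition apply_at :: "real set \<Rightarrow> complex ^ 'n ^ 'n \<Rightarrow> 'n::finite state \<Rightarrow> 'n state" where
  "apply_at I A \<psi> = (\<lambda>s. \<Sum>j\<in>UNIV. A $ s I $ j * \<psi> (s(I := j)))"

text \<open>
  \<open>V\<close> applied to the factor of \<open>dyadic k a\<close>, with the first factor of the target placed at the left
  half of that interval and the second at the right half.
\<close>

definition apply_halving ::
  "complex ^ 'n ^ ('n \<times> 'n) \<Rightarrow> nat \<Rightarrow> nat \<Rightarrow> 'n::finite state \<Rightarrow> 'n state" where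
  "apply_halving V k a \<psi> =
     (\<lambda>s. \<Sum>i\<in>UNIV. V $ (s (dyadic (Suc k) (2 * a)), s (dyadic (Suc k) (2 * a + 1))) $ i
                    * \<psi> (s(dyadic k a := i)))"

definition halve :: "real set set \<Rightarrow> nat \<Rightarrow> nat \<Rightarrow> real set set" where
  "halve P k a = (P - {dyadic k a}) \<union> {dyadic (Suc k) (2 * a), dyadic (Suc k) (2 * a + 1)}"

inductive halving_map ::
  "complex ^ 'n::finite ^ ('n \<times> 'n) \<Rightarrow> real set set \<Rightarrow> real set set \<Rightarrow> ('n state \<Rightarrow> 'n state) \<Rightarrow> bool"
  for V where
  none: "halving_map V P P id"
| step: "dyadic k a \<in> P \<Longrightarrow> halving_map V (halve P k a) Q \<Phi> \<Longrightarrow>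
         halving_map V P Q (\<Phi> \<circ> apply_halving V k a)"

text \<open>
  The result depends neither on the order of the halvings nor on anything else besides \<open>V\<close>, \<open>P\<close> and
  \<open>Q\<close>; see \<open>halving_map_ex1\<close> below.
\<close>

definition refine_map ::
  "complex ^ 'n::finite ^ ('n \<times> 'n) \<Rightarrow> real set set \<Rightarrow> real set set \<Rightarrow> 'n state \<Rightarrow> 'n state" where
  "refine_map V P Q = (THE \<Phi>. halving_map V P Q \<Phi>)"

definition vacuum ::
  "complex ^ 'n::finite ^ ('n \<times> 'n) \<Rightarrow> complex ^ 'n \<Rightarrow> real set set \<Rightarrow> 'n state" where
  "vacuum V \<omega> P = refine_map V {{0..<1}} P (\<lambda>s. \<omega> $ s {0..<1})"


section \<open>Fields\<close>

text \<open>
  For an interval in a dyadic partition the binary logarithm of the length is an integer, so taking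
  the floor only changes its type.
\<close>

definition field_op ::
  "(nat \<Rightarrow> complex) \<Rightarrow> (nat \<Rightarrow> complex ^ 'n ^ 'n) \<Rightarrow> real set set \<Rightarrow> nat \<Rightarrow> real \<Rightarrow>
   'n::finite state \<Rightarrow> 'n state" where
  "field_op lam mu Q \<alpha> z \<psi> =
     (\<lambda>s. \<Sum>I\<in>Q. indicator I z * lam \<alpha> powi \<lfloor>log 2 (measure lborel I)\<rfloor> * apply_at I (mu \<alpha>) \<psi> s)"

definition M_op ::
  "(nat \<Rightarrow> complex) \<Rightarrow> (nat \<Rightarrow> complex ^ 'n ^ 'n) \<Rightarrow> real set set \<Rightarrow> nat list \<Rightarrow> real list \<Rightarrow>
   'n::finite state \<Rightarrow> 'n state" where
  "M_op lam mu Q \<alpha>s xs = foldr (\<lambda>(\<alpha>, x) A. field_op lam mu Q \<alpha> x \<circ> A) (zip \<alpha>s xs) id"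


section \<open>Well-definedness\<close>

lemma mem_dyadic_iff: "x \<in> dyadic k a \<longleftrightarrow> \<lfloor>x * 2 ^ k\<rfloor> = int a"
  by (auto simp: dyadic_def floor_eq_iff field_simps)

lemma dyadic_nonempty: "dyadic k a \<noteq> {}"
proof -
  have "real a / 2 ^ k \<in> dyadic k a" by (simp add: mem_dyadic_iff)
  then show ?thesis by blast
qed

lemma measure_dyadic: "measure lborel (dyadic k a) = 1 / 2 ^ k"
  by (simp add: dyadic_def divide_right_mono add_divide_distrib)

lemma dyadic_eq_iff: "dyadic k a = dyadic l b \<longleftrightarrow> k = l \<and> a = b"
proof
  assume eq: "dyadic k a = dyadic l b"
  then have "1 / 2 ^ k = (1 / 2 ^ l :: real)" by (metis measure_dyadic)
  then have "k = l" by simp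
  moreover from dyadic_nonempty obtain x where "x \<in> dyadic k a" by blast
  ultimately show "k = l \<and> a = b" using eq by (metis mem_dyadic_iff of_nat_eq_iff)
qed simp

lemma floor_coarsen:
  fixes x :: real
  assumes "k \<le> l"
  shows "\<lfloor>x * 2 ^ k\<rfloor> = \<lfloor>x * 2 ^ l\<rfloor> div 2 ^ (l - k)"
proof -
  have "x * 2 ^ k = x * 2 ^ l / real_of_int (2 ^ (l - k))"
    using assms by (simp add: field_simps flip: power_add)
  then show ?thesis by (metis floor_divide_real_eq_div zero_le_numeral zero_le_power)
qed

lemma dyadic_nested:
  assumes "k \<le> l" "x \<in> dyadic k a" "x \<in> dyadic l b"
  shows "dyadic l b \<subseteq> dyadic k a"
  using assms by (auto simp: mem_dyadic_iff floor_coarsen[OF assms(1)])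

lemma dyadic_Un: "dyadic k a = dyadic (Suc k) (2 * a) \<union> dyadic (Suc k) (2 * a + 1)"
proof -
  have "\<lfloor>x * 2 ^ k\<rfloor> = int a \<longleftrightarrow>
      \<lfloor>x * 2 ^ Suc k\<rfloor> = int (2 * a) \<or> \<lfloor>x * 2 ^ Suc k\<rfloor> = int (2 * a + 1)" for x :: real
    unfolding floor_coarsen[of k "Suc k" x, OF le_SucI[OF order_refl]] by auto
  then show ?thesis by (auto simp: mem_dyadic_iff simp del: power_Suc)
qed

lemma dyadic_disjoint: "disjnt (dyadic (Suc k) (2 * a)) (dyadic (Suc k) (2 * a + 1))"
  by (auto simp: disjnt_iff mem_dyadic_iff)

lemma partD:
  assumes "P \<in> dyadic_partitions" "I \<in> P" "J \<in> P" "x \<in> I" "x \<in> J"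
  shows "I = J"
proof -
  have "disjoint P" using assms(1) by (simp add: dyadic_partitions_def partition_on_def)
  then show ?thesis using assms(2-) by (meson disjnt_iff pairwiseD)
qed

lemma dyadic_halves_subset:
  "dyadic (Suc k) (2 * a) \<subseteq> dyadic k a" "dyadic (Suc k) (2 * a + 1) \<subseteq> dyadic k a"
  unfolding dyadic_Un[of k a] by simp_all

lemma half_not_mem:
  assumes "P \<in> dyadic_partitions" "dyadic k a \<in> P"
  shows "dyadic (Suc k) (2 * a) \<notin> P" "dyadic (Suc k) (2 * a + 1) \<notin> P"
proof -
  have "J \<notin> P" if J: "J = dyadic (Suc k) b" "J \<subseteq> dyadic k a" for J b
  proof
    assume "J \<in> P"
    obtain x where "x \<in> J" using J(1) dyadic_nonempty by blast
    then have "x \<in> dyadic k a" using J(2) by blast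
    then have "J = dyadic k a"
      using partD[OF assms(1) \<open>J \<in> P\<close> assms(2) \<open>x \<in> J\<close>] by simp
    then show False using J(1) by (simp add: dyadic_eq_iff)
  qed
  then show "dyadic (Suc k) (2 * a) \<notin> P" "dyadic (Suc k) (2 * a + 1) \<notin> P"
    using dyadic_halves_subset by simp_all
qed

lemma refinesE:
  assumes "refines A Q P" "J \<in> Q"
  obtains I where "I \<in> P" "J \<subseteq> I"
  using assms unfolding refines_def by blast

lemma halve_dyadic_partition:
  assumes "P \<in> dyadic_partitions" "dyadic k a \<in> P"
  shows "halve P k a \<in> dyadic_partitions" "refines {0..<1} (halve P k a) P"
proof -
  have P: "partition_on {0..<1} P" "finite P" and d: "\<And>I. I \<in> P \<Longrightarrow> \<exists>k a. I = dyadic k a"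
    using assms(1) by (auto simp: dyadic_partitions_def)
  let ?L = "dyadic (Suc k) (2 * a)" and ?R = "dyadic (Suc k) (2 * a + 1)"
  have h: "halve P k a = insert ?L (insert ?R (P - {dyadic k a}))"
    by (auto simp: halve_def)
  have dis: "disjnt I (dyadic k a)" if "I \<in> P - {dyadic k a}" for I
    using partD[OF assms(1)] that assms(2) by (auto simp: disjnt_iff)
  have part: "partition_on {0..<1} (halve P k a)"
  proof (rule partition_onI)
    show "\<Union> (halve P k a) = {0..<1}"
      using partition_onD1[OF P(1)] assms(2) dyadic_Un[of k a] unfolding h by blast
    show "{} \<notin> halve P k a"
      using partition_onD3[OF P(1)] dyadic_nonempty unfolding h by blast
    fix p q assume pq: "p \<in> halve P k a" "q \<in> halve P k a" "p \<noteq> q"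
    have *: "disjnt p ?L \<and> disjnt p ?R" if "p \<in> P - {dyadic k a}" for p
      using dis[OF that] dyadic_Un[of k a] by (auto simp: disjnt_iff)
    have **: "disjnt p q" if "p \<in> P - {dyadic k a}" "q \<in> P - {dyadic k a}"
      using that pq(3) partD[OF assms(1)] by (auto simp: disjnt_iff)
    show "disjnt p q"
      using pq *[of p] *[of q] ** dyadic_disjoint[of k a] unfolding h insert_iff
      by (metis disjnt_sym)
  qed
  show "halve P k a \<in> dyadic_partitions"
    using part P(2) d unfolding dyadic_partitions_def h by auto
  have "\<exists>Y\<in>P. X \<subseteq> Y" if "X \<in> halve P k a" for X
    using that assms(2) dyadic_Un[of k a] unfolding h by auto
  then show "refines {0..<1} (halve P k a) P"
    using part P(1) by (simp add: refines_def)
qed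

lemma halving_map_refines:
  assumes "halving_map V P Q \<Phi>" "P \<in> dyadic_partitions"
  shows "Q \<in> dyadic_partitions \<and> refines {0..<1} Q P"
  using assms
proof induction
  case (none P)
  then show ?case by (auto simp: dyadic_partitions_def intro: refines_refl)
next
  case (step k a P Q \<Phi>)
  then show ?case using halve_dyadic_partition refines_trans by blast
qed

lemma halving_map_not_mem:
  assumes "halving_map V (halve P k a) Q \<Phi>" "P \<in> dyadic_partitions" "dyadic k a \<in> P"
  shows "dyadic k a \<notin> Q"
proof
  assume "dyadic k a \<in> Q"
  have h: "halve P k a \<in> dyadic_partitions" using assms halve_dyadic_partition by blast
  then have "refines {0..<1} Q (halve P k a)" using halving_map_refines assms(1) by blast
  then obtain Y where Y: "Y \<in> halve P k a" "dyadic k a \<subseteq> Y"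
    using refinesE \<open>dyadic k a \<in> Q\<close> by blast
  let ?L = "dyadic (Suc k) (2 * a)" and ?R = "dyadic (Suc k) (2 * a + 1)"
  have LR: "?L \<in> halve P k a" "?R \<in> halve P k a" by (auto simp: halve_def)
  obtain x y where xy: "x \<in> ?L" "y \<in> ?R" using dyadic_nonempty by blast
  then have "x \<in> Y" "y \<in> Y" using Y(2) dyadic_halves_subset[of k a] by blast+
  then have "Y = ?L" "Y = ?R" using partD[OF h Y(1)] LR xy by simp_all
  then show False by (simp add: dyadic_eq_iff)
qed

lemma apply_halving_commute:
  assumes P: "P \<in> dyadic_partitions" "dyadic k a \<in> P" "dyadic l b \<in> P" "dyadic k a \<noteq> dyadic l b"
  shows "apply_halving V k a \<circ> apply_halving V l b = apply_halving V l b \<circ> apply_halving V k a"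
proof -
  have ne: "dyadic (Suc k) (2 * a) \<noteq> dyadic l b" "dyadic (Suc k) (2 * a + 1) \<noteq> dyadic l b"
      "dyadic (Suc l) (2 * b) \<noteq> dyadic k a" "dyadic (Suc l) (2 * b + 1) \<noteq> dyadic k a"
    using half_not_mem[OF P(1,2)] half_not_mem[OF P(1,3)] P by metis+
  have *: "(\<Sum>i\<in>UNIV. V $ (s L, s R) $ i * (\<Sum>j\<in>UNIV.
              V $ ((s(I := i)) L', (s(I := i)) R') $ j * \<psi> (s(I := i, J := j)))) =
           (\<Sum>j\<in>UNIV. V $ (s L', s R') $ j * (\<Sum>i\<in>UNIV.
              V $ ((s(J := j)) L, (s(J := j)) R) $ i * \<psi> (s(J := j, I := i))))"
    if "L \<noteq> J" "R \<noteq> J" "L' \<noteq> I" "R' \<noteq> I" "I \<noteq> J" for s \<psi> and L R L' R' I J :: "real set"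
    using that by (simp add: sum_distrib_left fun_upd_twist[OF \<open>I \<noteq> J\<close>] mult_ac) (rule sum.swap)
  show ?thesis
    unfolding apply_halving_def comp_def by (intro ext *[OF ne P(4)])
qed

lemma halving_map_extract:
  assumes "halving_map V P Q \<Phi>" "P \<in> dyadic_partitions" "dyadic k a \<in> P" "dyadic k a \<notin> Q"
  shows "\<exists>\<Phi>'. halving_map V (halve P k a) Q \<Phi>' \<and> \<Phi> = \<Phi>' \<circ> apply_halving V k a"
  using assms
proof induction
  case (none P)
  then show ?case by simp
next
  case (step l b P Q \<Phi>)
  show ?case
  proof (cases "dyadic k a = dyadic l b")
    case True
    then show ?thesis using step.hyps by (auto simp: dyadic_eq_iff)
  next
    case False
    have "dyadic k a \<in> halve P l b" using step.prems False by (auto simp: halve_def)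
    then obtain \<Phi>' where \<Phi>': "halving_map V (halve (halve P l b) k a) Q \<Phi>'"
        "\<Phi> = \<Phi>' \<circ> apply_halving V k a"
      using step.IH step.prems step.hyps halve_dyadic_partition by blast
    have "halve (halve P l b) k a = halve (halve P k a) l b"
    proof -
      have ne: "dyadic (Suc k) (2 * a) \<noteq> dyadic l b" "dyadic (Suc k) (2 * a + 1) \<noteq> dyadic l b"
          "dyadic (Suc l) (2 * b) \<noteq> dyadic k a" "dyadic (Suc l) (2 * b + 1) \<noteq> dyadic k a"
        using half_not_mem[OF step.prems(1,2)] half_not_mem[OF step.prems(1) step.hyps(1)]
          step.prems(2) step.hyps(1) by metis+
      have "(P - {J} \<union> {L', R'}) - {I} \<union> {L, R} = (P - {I} \<union> {L, R}) - {J} \<union> {L', R'}"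
        if "L \<noteq> J" "R \<noteq> J" "L' \<noteq> I" "R' \<noteq> I" for L R L' R' I J
        using that by blast
      from this[OF ne] show ?thesis unfolding halve_def .
    qed
    moreover have "dyadic l b \<in> halve P k a" using False step.hyps by (auto simp: halve_def)
    ultimately have "halving_map V (halve P k a) Q (\<Phi>' \<circ> apply_halving V l b)"
      using \<Phi>'(1) halving_map.step by metis
    moreover have "\<Phi> \<circ> apply_halving V l b = (\<Phi>' \<circ> apply_halving V l b) \<circ> apply_halving V k a"
      unfolding \<Phi>'(2)
      using apply_halving_commute[OF step.prems(1,2) step.hyps(1) False, of V]
      by (metis comp_assoc)
    ultimately show ?thesis by blast
  qed
qed

lemma halving_map_unique:
  assumes "halving_map V P Q \<Phi>" "halving_map V P Q \<Phi>'" "P \<in> dyadic_partitions"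
  shows "\<Phi> = \<Phi>'"
  using assms
proof (induction arbitrary: \<Phi>')
  case (none P)
  from none(1) show ?case
    by cases (use none halving_map_not_mem in blast)+
next
  case (step k a P Q \<Phi>)
  have "dyadic k a \<notin> Q" using step.hyps step.prems halving_map_not_mem by blast
  then obtain \<Phi>'' where "halving_map V (halve P k a) Q \<Phi>''" "\<Phi>' = \<Phi>'' \<circ> apply_halving V k a"
    using halving_map_extract step.prems step.hyps by blast
  then show ?case using step.IH step.hyps step.prems halve_dyadic_partition by blast
qed

lemma card_halve:
  assumes "P \<in> dyadic_partitions" "dyadic k a \<in> P"
  shows "card (halve P k a) = Suc (card P)"
proof -
  have fin: "finite P" using assms by (auto simp: dyadic_partitions_def)
  have h: "halve P k a =
      insert (dyadic (Suc k) (2 * a)) (insert (dyadic (Suc k) (2 * a + 1)) (P - {dyadic k a}))"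
    by (auto simp: halve_def)
  have "card P > 0" using fin assms(2) card_gt_0_iff by blast
  then show ?thesis
    using fin half_not_mem[OF assms] assms(2) unfolding h by (simp add: dyadic_eq_iff)
qed

lemma refines_card_le:
  assumes "P \<in> dyadic_partitions" "Q \<in> dyadic_partitions" "refines {0..<1} Q P"
  shows "card P \<le> card Q"
proof -
  have "\<exists>J\<in>Q. J \<subseteq> I" if IP: "I \<in> P" for I
  proof -
    have "I \<noteq> {}" "\<Union>P = {0..<1}" "\<Union>Q = {0..<1}"
      using IP assms by (auto simp: dyadic_partitions_def partition_on_def)
    then obtain x where "x \<in> I" "x \<in> \<Union>Q" using IP by (metis UnionI all_not_in_conv)
    then obtain J where x: "x \<in> I" "x \<in> J" "J \<in> Q" by blast
    obtain I' where I': "I' \<in> P" "J \<subseteq> I'" using refinesE[OF assms(3) x(3)] .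
    have "x \<in> I'" using I'(2) x(2) by (rule subsetD)
    then have "I = I'" using partD[OF assms(1) IP I'(1) x(1)] by simp
    then show ?thesis using I' x(3) by (intro bexI[of _ J]) simp_all
  qed
  then have "\<forall>I\<in>P. \<exists>J. J \<in> Q \<and> J \<subseteq> I" by (simp add: Bex_def)
  from bchoice[OF this] obtain f where f': "\<forall>I\<in>P. f I \<in> Q \<and> f I \<subseteq> I" by (elim exE)
  then have f: "f I \<in> Q" "f I \<subseteq> I" if "I \<in> P" for I using that by simp_all
  have "inj_on f P"
  proof (rule inj_onI)
    fix I I' assume *: "I \<in> P" "I' \<in> P" "f I = f I'"
    have "{} \<notin> Q" using assms(2) by (simp add: dyadic_partitions_def partition_on_def)
    then have "f I \<noteq> {}" using f(1)[OF *(1)] by metis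
    then obtain x where x: "x \<in> f I" by blast
    then have "x \<in> f I'" using *(3) by simp
    then have "x \<in> I" "x \<in> I'" using f(2)[OF *(1)] f(2)[OF *(2)] x by (simp_all add: subsetD)
    then show "I = I'" using partD[OF assms(1) *(1,2)] by simp
  qed
  moreover have "f ` P \<subseteq> Q" using f(1) by (rule image_subsetI)
  moreover have "finite Q" using assms(2) by (simp add: dyadic_partitions_def)
  ultimately show ?thesis by (rule card_inj_on_le)
qed

lemma refines_halve:
  assumes P: "P \<in> dyadic_partitions" and Q: "Q \<in> dyadic_partitions"
    and r: "refines {0..<1} Q P" and I: "dyadic k a \<in> P" "dyadic k a \<notin> Q"
  shows "refines {0..<1} Q (halve P k a)"
proof -
  have "\<exists>Y\<in>halve P k a. X \<subseteq> Y" if XQ: "X \<in> Q" for X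
  proof -
    obtain Y where Y: "Y \<in> P" "X \<subseteq> Y" using refinesE[OF r XQ] .
    show ?thesis
    proof (cases "Y = dyadic k a")
      case False
      then show ?thesis using Y by (auto simp: halve_def)
    next
      case True
      obtain l b where X: "X = dyadic l b" using Q XQ by (auto simp: dyadic_partitions_def)
      obtain x where x: "x \<in> X" using X dyadic_nonempty by blast
      have "k < l"
      proof (rule ccontr)
        assume "\<not> k < l"
        then have "dyadic k a \<subseteq> X" using dyadic_nested[of l k x b a] x X Y True by auto
        then show False using Y True I XQ by auto
      qed
      have "x \<in> dyadic (Suc k) (2 * a) \<or> x \<in> dyadic (Suc k) (2 * a + 1)"
        using x Y True dyadic_Un[of k a] by auto
      then have "X \<subseteq> dyadic (Suc k) (2 * a) \<or> X \<subseteq> dyadic (Suc k) (2 * a + 1)"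
        using dyadic_nested[of "Suc k" l x] \<open>k < l\<close> x X by (metis Suc_leI)
      then show ?thesis by (auto simp: halve_def)
    qed
  qed
  then show ?thesis
    using r halve_dyadic_partition[OF P I(1)] by (auto simp: refines_def)
qed

lemma halving_map_exists:
  assumes "P \<in> dyadic_partitions" "Q \<in> dyadic_partitions" "refines {0..<1} Q P"
  shows "\<exists>\<Phi>. halving_map V P Q \<Phi>"
  using assms
proof (induction "card Q - card P" arbitrary: P rule: less_induct)
  case less
  show ?case
  proof (cases "P \<subseteq> Q")
    case True
    have "Q \<subseteq> P"
    proof
      fix J assume J: "J \<in> Q"
      obtain I where I: "I \<in> P" "J \<subseteq> I" using refinesE[OF less.prems(3) J] .
      have "J \<noteq> {}" using J less.prems by (auto simp: dyadic_partitions_def partition_on_def)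
      then obtain x where "x \<in> J" by blast
      moreover have "x \<in> I" "I \<in> Q" using calculation I True by auto
      ultimately have "J = I" using partD[OF less.prems(2) J] by simp
      then show "J \<in> P" using I by simp
    qed
    then show ?thesis using True halving_map.none by (metis subset_antisym)
  next
    case False
    then obtain k a where I: "dyadic k a \<in> P" "dyadic k a \<notin> Q"
      using less.prems(1) by (force simp: dyadic_partitions_def)
    have h: "halve P k a \<in> dyadic_partitions" using halve_dyadic_partition less.prems I by blast
    have r: "refines {0..<1} Q (halve P k a)" using refines_halve less.prems I by blast
    have "card (halve P k a) \<le> card Q" using refines_card_le[OF h less.prems(2) r] .
    then have "card Q - card (halve P k a) < card Q - card P"
      using card_halve[OF less.prems(1) I(1)] by simp
    from less.hyps[OF this h less.prems(2) r] show ?thesis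
      using I halving_map.step by blast
  qed
qed

lemma halving_map_ex1:
  assumes "P \<in> dyadic_partitions" "Q \<in> dyadic_partitions" "refines {0..<1} Q P"
  shows "\<exists>!\<Phi>. halving_map V P Q \<Phi>"
  using halving_map_exists[OF assms] halving_map_unique assms(1) by blast

lemma halving_map_refine_map:
  assumes "P \<in> dyadic_partitions" "Q \<in> dyadic_partitions" "refines {0..<1} Q P"
  shows "halving_map V P Q (refine_map V P Q)"
  unfolding refine_map_def by (rule theI'[OF halving_map_ex1[OF assms]])

lemma halving_map_tensor_space:
  assumes "halving_map V P Q \<Phi>" "\<psi> \<in> tensor_space P"
  shows "\<Phi> \<psi> \<in> tensor_space Q"
  using assms
proof (induction arbitrary: \<psi>)
  case (none P)
  then show ?case by simp
next
  case (step k a P Q \<Phi>)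
  have "apply_halving V k a \<psi> s = apply_halving V k a \<psi> t"
    if st: "\<forall>I\<in>halve P k a. s I = t I" for s t
  proof -
    have "\<psi> (s(dyadic k a := i)) = \<psi> (t(dyadic k a := i))" for i
      using step.prems st unfolding tensor_space_def halve_def by auto
    then show ?thesis using st by (simp add: apply_halving_def halve_def)
  qed
  then have "apply_halving V k a \<psi> \<in> tensor_space (halve P k a)" by (auto simp: tensor_space_def)
  then show ?case using step.IH by simp
qed

lemma directed_dyadic_partitions:
  assumes P: "P \<in> dyadic_partitions" and Q: "Q \<in> dyadic_partitions"
  shows "\<exists>R\<in>dyadic_partitions. refines {0..<1} R P \<and> refines {0..<1} R Q"
proof -
  define R where "R = {I \<inter> J | I J. I \<in> P \<and> J \<in> Q} - {{}}"
  have p: "\<Union>P = {0..<1}" "\<Union>Q = {0..<1}" "finite P" "finite Q"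
    using P Q by (simp_all add: dyadic_partitions_def partition_on_def)
  have "R \<subseteq> (\<lambda>(I, J). I \<inter> J) ` (P \<times> Q)" by (auto simp: R_def)
  then have fin: "finite R" using p(3,4) finite_subset by blast
  have part: "partition_on {0..<1} R"
  proof (rule partition_onI)
    have "\<Union>R = \<Union>P \<inter> \<Union>Q" by (auto simp: R_def)
    then show "\<Union>R = {0..<1}" using p by simp
    show "{} \<notin> R" by (simp add: R_def)
    fix A B assume "A \<in> R" "B \<in> R" "A \<noteq> B"
    then obtain I J I' J' where "A = I \<inter> J" "B = I' \<inter> J'" "I \<in> P" "I' \<in> P" "J \<in> Q" "J' \<in> Q"
      unfolding R_def by blast
    note AB = this
    have "x \<notin> B" if xA: "x \<in> A" for x
    proof
      assume xB: "x \<in> B"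
      have "I = I'" using xA xB unfolding AB(1,2) by (intro partD[OF P AB(3,4), of x]) simp_all
      moreover have "J = J'"
        using xA xB unfolding AB(1,2) by (intro partD[OF Q AB(5,6), of x]) simp_all
      ultimately show False using \<open>A \<noteq> B\<close> AB(1,2) by simp
    qed
    then show "disjnt A B" by (simp add: disjnt_iff)
  qed
  have "\<exists>k a. A = dyadic k a" if AR: "A \<in> R" for A
  proof -
    have "\<exists>I J. A = I \<inter> J \<and> I \<in> P \<and> J \<in> Q \<and> A \<noteq> {}" using AR by (simp add: R_def)
    then obtain I J where A: "A = I \<inter> J" "I \<in> P" "J \<in> Q" "A \<noteq> {}" by (elim exE conjE)
    have "\<exists>k a. I = dyadic k a" "\<exists>l b. J = dyadic l b"
      using A(2,3) P Q by (simp_all add: dyadic_partitions_def)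
    then obtain k a l b where IJ: "I = dyadic k a" "J = dyadic l b" by (elim exE)
    obtain x where "x \<in> A" using A(4) by (metis all_not_in_conv)
    then have x: "x \<in> dyadic k a" "x \<in> dyadic l b" unfolding A(1) IJ by simp_all
    show ?thesis
    proof (cases "k \<le> l")
      case True
      have "A = dyadic l b" using dyadic_nested[OF True x] unfolding A(1) IJ by (rule Int_absorb1)
      then show ?thesis by (intro exI)
    next
      case False
      then have "l \<le> k" by simp
      then have "A = dyadic k a"
        using dyadic_nested[OF _ x(2,1)] unfolding A(1) IJ by (intro Int_absorb2)
      then show ?thesis by (intro exI)
    qed
  qed
  then have "R \<in> dyadic_partitions" using fin part by (simp add: dyadic_partitions_def)
  moreover have "\<forall>A\<in>R. \<exists>I\<in>P. A \<subseteq> I" "\<forall>A\<in>R. \<exists>J\<in>Q. A \<subseteq> J"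
    unfolding R_def by blast+
  then have "refines {0..<1} R P" "refines {0..<1} R Q"
    using part P Q by (simp_all add: refines_def dyadic_partitions_def)
  ultimately show ?thesis by blast
qed

lemma eventually_refinement_net:
  assumes P: "P \<in> dyadic_partitions"
  shows "eventually R (refinement_net P) \<longleftrightarrow>
    (\<exists>Q0\<in>dyadic_partitions. refines {0..<1} Q0 P \<and>
       (\<forall>Q\<in>dyadic_partitions. refines {0..<1} Q Q0 \<longrightarrow> R Q))"
proof -
  let ?B = "{Q \<in> dyadic_partitions. refines {0..<1} Q P}"
  let ?F = "\<lambda>Q0. principal {Q \<in> dyadic_partitions. refines {0..<1} Q Q0}"
  have "partition_on {0..<1} P" using P by (simp add: dyadic_partitions_def)
  then have "P \<in> ?B" using P refines_refl by simp
  then have ne: "?B \<noteq> {}" by (metis empty_iff)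
  have dir: "\<exists>C\<in>?B. ?F C \<le> inf (?F A) (?F B)" if AB: "A \<in> ?B" "B \<in> ?B" for A B
  proof -
    have "A \<in> dyadic_partitions" "B \<in> dyadic_partitions" using AB by simp_all
    from directed_dyadic_partitions[OF this]
    obtain C where C: "C \<in> dyadic_partitions" "refines {0..<1} C A" "refines {0..<1} C B"
      by (elim bexE conjE)
    have "C \<in> ?B" using C(1) refines_trans[OF C(2)] AB(1) by simp
    moreover have "?F C \<le> inf (?F A) (?F B)"
      using refines_trans[OF _ C(2)] refines_trans[OF _ C(3)] by auto
    ultimately show ?thesis by (rule bexI[rotated])
  qed
  have "eventually R (refinement_net P) \<longleftrightarrow> (\<exists>Q0\<in>?B. eventually R (?F Q0))"
    unfolding refinement_net_def by (rule eventually_INF_base[OF ne dir])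
  then show ?thesis by (simp add: eventually_principal Bex_def Ball_def conj_assoc imp_conjL)
qed

lemma refinement_net_nontrivial:
  assumes "P \<in> dyadic_partitions"
  shows "refinement_net P \<noteq> bot"
proof -
  have "refines {0..<1} Q Q" if "Q \<in> dyadic_partitions" for Q
    using that by (intro refines_refl) (simp add: dyadic_partitions_def)
  then have "\<not> eventually (\<lambda>_. False) (refinement_net P)"
    unfolding eventually_refinement_net[OF assms] by blast
  then show ?thesis by (simp add: trivial_limit_def)
qed

end

theory Submission
  imports Defs
begin

text \<open>
  The net is constant. Passing from \<open>Q\<close> to a finer partition is a sequence of halvings, and the
  halving of \<open>I \<in> Q\<close> applies \<open>V\<close> to the vacuum and commutes with the fields away from \<open>I\<close>. As \<open>I\<close>
  contains at most one of the points, at most one field remains. Its matrix is conjugated by \<open>V\<close> into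
  \<open>E (\<lambda>\<^sub>\<alpha>\<^bsup>-(k+1)\<^esup> \<mu>\<^sup>\<alpha>) = \<lambda>\<^sub>\<alpha>\<^bsup>-k\<^esup> \<mu>\<^sup>\<alpha>\<close> (for \<open>I\<close> of length \<open>2\<^bsup>-k\<^esup>\<close>), whichever half contains the
  point, by the swap symmetry of \<open>V\<close>; if no field remains, \<open>E 1 = 1\<close> is used instead.
\<close>

section \<open>Splitting one tensor factor, and operators on single factors\<close>

text \<open>Leaving the three intervals arbitrary lets the two halves be exchanged, which the fixed
  left and right halves in \<open>apply_halving\<close> do not allow.\<close>

definition split_factor ::
  "complex ^ 'n ^ ('n \<times> 'n) \<Rightarrow> real set \<Rightarrow> real set \<Rightarrow> real set \<Rightarrow> 'n::finite state \<Rightarrow> 'n state" where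
  "split_factor V I J K \<psi> = (\<lambda>s. \<Sum>i\<in>UNIV. V $ (s J, s K) $ i * \<psi> (s(I := i)))"

lemma apply_halving_eq_split_factor:
  "apply_halving V k a = split_factor V (dyadic k a) (dyadic (Suc k) (2 * a)) (dyadic (Suc k) (2 * a + 1))"
  by (simp add: fun_eq_iff apply_halving_def split_factor_def)

text \<open>Applied to the basis vectors \<open>axis k 1\<close>, swap invariance becomes a symmetry
  of the columns of \<open>V\<close>.\<close>

lemma swap_invariant_entries:
  fixes V :: "complex ^ 'n::finite ^ ('n \<times> 'n)"
  assumes "\<And>v. swap_vec (V *v v) = V *v v"
  shows "V $ (i, j) $ k = V $ (j, i) $ k"
proof -
  have "(V *v axis k 1) $ p = V $ p $ k" for p
    by (simp add: matrix_vector_mult_def axis_def if_distrib[of "\<lambda>x. _ * x"] cong: if_cong)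
  then show ?thesis
    using arg_cong[OF assms[of "axis k 1"], of "\<lambda>w. w $ (i, j)"] by (simp add: swap_vec_def)
qed

lemma split_factor_swap:
  assumes "\<And>v. swap_vec (V *v v) = V *v v"
  shows "split_factor V I J K = split_factor V I K J"
proof (intro ext)
  fix \<psi> s
  show "split_factor V I J K \<psi> s = split_factor V I K J \<psi> s"
    by (simp only: split_factor_def swap_invariant_entries[OF assms, of "s J" "s K"])
qed

lemma apply_at_mat_1 [simp]: "apply_at I (mat 1) \<psi> = \<psi>"
  by (simp add: apply_at_def mat_def if_distrib[of "\<lambda>x. x * _"] fun_eq_iff cong: if_cong)

lemma apply_at_commute:
  assumes "I \<noteq> J"
  shows "apply_at I A (apply_at J B \<psi>) = apply_at J B (apply_at I A \<psi>)"
  using assms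
  by (simp add: apply_at_def fun_eq_iff sum_distrib_left fun_upd_twist[OF assms] mult_ac)
    (intro allI sum.swap)

text \<open>The splitting reads the labels at \<open>L\<close> and \<open>R\<close> and overwrites
  the one at \<open>I\<close>, so an operator acting on a fourth label passes through it.\<close>

lemma apply_at_split_factor:
  assumes "J \<noteq> I" "J \<noteq> L" "J \<noteq> R"
  shows "apply_at J A (split_factor V I L R \<psi>) = split_factor V I L R (apply_at J A \<psi>)"
  using assms
  by (simp add: apply_at_def split_factor_def fun_eq_iff sum_distrib_left
      fun_upd_twist[OF assms(1)] mult_ac) (intro allI sum.swap)

lemma apply_at_tensor_space:
  assumes "\<psi> \<in> tensor_space Q" "I \<in> Q"
  shows "apply_at I A \<psi> \<in> tensor_space Q"
proof -
  have "apply_at I A \<psi> s = apply_at I A \<psi> t" if st: "\<forall>I\<in>Q. s I = t I" for s t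
  proof -
    have "\<psi> (s(I := j)) = \<psi> (t(I := j))" for j
      using assms(1) st by (simp add: tensor_space_def)
    then show ?thesis using st assms(2) by (simp add: apply_at_def)
  qed
  then show ?thesis by (simp add: tensor_space_def)
qed

section \<open>Inner products after a splitting, in terms of \<open>E_map\<close>\<close>

text \<open>Peels off the label of one factor, so that inner products can be computed in that factor
  with all other labels fixed.\<close>

lemma sum_PiE_insert:
  assumes "finite S" "x \<notin> S"
  shows "(\<Sum>s \<in> insert x S \<rightarrow>\<^sub>E (UNIV :: 'b::finite set). f s) =
    (\<Sum>g \<in> S \<rightarrow>\<^sub>E UNIV. \<Sum>y\<in>UNIV. f (g(x := y)))"
proof -
  have "(\<Sum>s \<in> insert x S \<rightarrow>\<^sub>E (UNIV :: 'b set). f s) =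
      (\<Sum>(y, g) \<in> UNIV \<times> (S \<rightarrow>\<^sub>E UNIV). f (g(x := y)))"
    unfolding PiE_insert_eq
    by (subst sum.reindex) (auto simp: case_prod_beta intro!: inj_combinator assms)
  also have "\<dots> = (\<Sum>y\<in>UNIV. \<Sum>g \<in> S \<rightarrow>\<^sub>E UNIV. f (g(x := y)))"
    by (simp add: sum.cartesian_product)
  also have "\<dots> = (\<Sum>g \<in> S \<rightarrow>\<^sub>E UNIV. \<Sum>y\<in>UNIV. f (g(x := y)))"
    by (rule sum.swap)
  finally show ?thesis .
qed

lemma sum_UNIV_prod:
  "(\<Sum>p \<in> (UNIV :: ('a::finite \<times> 'b::finite) set). f p) = (\<Sum>i\<in>UNIV. \<Sum>j\<in>UNIV. f (i, j))"
  by (simp add: sum.cartesian_product)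

text \<open>The identity on the second factor forces both entries of \<open>V\<close> to share the
  label \<open>r\<close>. It is summed outermost because \<open>split_factor_inner\<close> produces
  the sums in that order.\<close>

lemma E_map_entry:
  "E_map V A $ i $ j =
    (\<Sum>r\<in>UNIV. \<Sum>l\<in>UNIV. \<Sum>m\<in>UNIV. cnj (V $ (l, r) $ i) * A $ l $ m * V $ (m, r) $ j)"
proof -
  have "E_map V A $ i $ j =
    (\<Sum>m\<in>UNIV. \<Sum>r\<in>UNIV. \<Sum>l\<in>UNIV. cnj (V $ (l, r) $ i) * A $ l $ m * V $ (m, r) $ j)"
    by (simp add: E_map_def matrix_matrix_mult_def adjoint_matrix_def tensor_mat_def mat_def
        sum_UNIV_prod sum_distrib_right mult.assoc if_distrib[of "\<lambda>x. x * _"]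
        if_distrib[of "\<lambda>x. _ * x"] cong: if_cong)
  also have "\<dots> =
    (\<Sum>r\<in>UNIV. \<Sum>m\<in>UNIV. \<Sum>l\<in>UNIV. cnj (V $ (l, r) $ i) * A $ l $ m * V $ (m, r) $ j)"
    by (rule sum.swap)
  also have "\<dots> =
    (\<Sum>r\<in>UNIV. \<Sum>l\<in>UNIV. \<Sum>m\<in>UNIV. cnj (V $ (l, r) $ i) * A $ l $ m * V $ (m, r) $ j)"
    by (intro sum.cong refl sum.swap)
  finally show ?thesis .
qed

lemma E_map_mat_scale: "E_map V (mat_scale c A) = mat_scale c (E_map V A)"
  by (simp add: vec_eq_iff E_map_entry mat_scale_def sum_distrib_left mult_ac)

text \<open>This is <Vu, (A tensor 1) V w> = <u, E(A) w> in coordinates, where \<open>u\<close> and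
  \<open>w\<close> are the coordinates in the one factor to be split.\<close>

lemma E_map_form:
  "(\<Sum>r\<in>UNIV. \<Sum>l\<in>UNIV. cnj (\<Sum>i\<in>UNIV. V $ (l, r) $ i * u i) *
      (\<Sum>m\<in>UNIV. A $ l $ m * (\<Sum>j\<in>UNIV. V $ (m, r) $ j * w j))) =
    (\<Sum>i\<in>UNIV. cnj (u i) * (\<Sum>j\<in>UNIV. E_map V A $ i $ j * w j))"
  (is "?lhs = ?rhs")
proof -
  let ?t = "\<lambda>r l m i j. cnj (u i) * cnj (V $ (l, r) $ i) * A $ l $ m * V $ (m, r) $ j * w j"
  \<comment> \<open>After expansion only the order of the five sums differs: adjacent swaps bring
    \<open>i\<close> and \<open>j\<close> to the outside.\<close>
  have "?lhs = (\<Sum>r\<in>UNIV. \<Sum>l\<in>UNIV. \<Sum>i\<in>UNIV. \<Sum>m\<in>UNIV. \<Sum>j\<in>UNIV. ?t r l m i j)"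
    by (simp add: sum_product sum_distrib_left mult_ac)
      (intro sum.cong refl trans[OF sum.cong[OF refl sum.swap] sum.swap])
  also have "\<dots> = (\<Sum>r\<in>UNIV. \<Sum>i\<in>UNIV. \<Sum>l\<in>UNIV. \<Sum>m\<in>UNIV. \<Sum>j\<in>UNIV. ?t r l m i j)"
    by (intro sum.cong refl sum.swap)
  also have "\<dots> = (\<Sum>i\<in>UNIV. \<Sum>r\<in>UNIV. \<Sum>l\<in>UNIV. \<Sum>m\<in>UNIV. \<Sum>j\<in>UNIV. ?t r l m i j)"
    by (rule sum.swap)
  also have "\<dots> = (\<Sum>i\<in>UNIV. \<Sum>r\<in>UNIV. \<Sum>l\<in>UNIV. \<Sum>j\<in>UNIV. \<Sum>m\<in>UNIV. ?t r l m i j)"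
    by (intro sum.cong refl sum.swap)
  also have "\<dots> = (\<Sum>i\<in>UNIV. \<Sum>r\<in>UNIV. \<Sum>j\<in>UNIV. \<Sum>l\<in>UNIV. \<Sum>m\<in>UNIV. ?t r l m i j)"
    by (intro sum.cong refl sum.swap)
  also have "\<dots> = (\<Sum>i\<in>UNIV. \<Sum>j\<in>UNIV. \<Sum>r\<in>UNIV. \<Sum>l\<in>UNIV. \<Sum>m\<in>UNIV. ?t r l m i j)"
    by (intro sum.cong refl sum.swap)
  also have "\<dots> = ?rhs"
    by (simp add: E_map_entry sum_distrib_left sum_distrib_right mult_ac)
  finally show ?thesis .
qed

text \<open>With the labels on \<open>S\<close> fixed, both sides are the two sides of
  \<open>E_map_form\<close>. The operator sits on \<open>J\<close>, the first target factor, as in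
  the definition of \<open>E_map\<close>.\<close>

lemma split_factor_inner:
  assumes fin: "finite S" and S: "I \<notin> S" "J \<notin> insert I S" "K \<notin> insert I S" "J \<noteq> K"
    and \<phi>: "\<phi> \<in> tensor_space (insert I S)" and \<psi>: "\<psi> \<in> tensor_space (insert I S)"
  shows "tensor_inner (insert J (insert K S)) (split_factor V I J K \<phi>)
      (apply_at J A (split_factor V I J K \<psi>)) =
    tensor_inner (insert I S) \<phi> (apply_at I (E_map V A) \<psi>)"
proof -
  \<comment> \<open>A vector over \<open>insert I S\<close> does not depend on the labels of the new
    intervals \<open>J\<close> and \<open>K\<close>.\<close>
  have upd: "\<xi> (g(K := r, J := l, I := i)) = \<xi> (g(I := i))"
    if "\<xi> \<in> tensor_space (insert I S)" for \<xi> :: "'a state" and g r l i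
  proof -
    have "\<forall>H\<in>insert I S. (g(K := r, J := l, I := i)) H = (g(I := i)) H"
      using S by (metis fun_upd_apply)
    then show ?thesis using that unfolding tensor_space_def by blast
  qed
  have split: "split_factor V I J K \<xi> (g(K := r, J := l)) = (\<Sum>i\<in>UNIV. V $ (l, r) $ i * \<xi> (g(I := i)))"
    if "\<xi> \<in> tensor_space (insert I S)" for \<xi> :: "'a state" and g r l
    using S(4) by (simp add: split_factor_def upd[OF that])
  have "tensor_inner (insert J (insert K S)) (split_factor V I J K \<phi>)
      (apply_at J A (split_factor V I J K \<psi>)) =
    (\<Sum>g \<in> S \<rightarrow>\<^sub>E UNIV. \<Sum>r\<in>UNIV. \<Sum>l\<in>UNIV.
      cnj (\<Sum>i\<in>UNIV. V $ (l, r) $ i * \<phi> (g(I := i))) *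
      (\<Sum>m\<in>UNIV. A $ l $ m * (\<Sum>j\<in>UNIV. V $ (m, r) $ j * \<psi> (g(I := j)))))"
    using fin S
    by (simp add: tensor_inner_def sum_PiE_insert apply_at_def split[OF \<phi>] split[OF \<psi>])
  also have "\<dots> = tensor_inner (insert I S) \<phi> (apply_at I (E_map V A) \<psi>)"
    using fin S(1) by (simp add: tensor_inner_def sum_PiE_insert apply_at_def E_map_form
        del: cnj_sum complex_cnj_mult)
  finally show ?thesis .
qed

text \<open>\<open>E_map\<close> has its argument on the first factor, which settles the left half.
  For the right half, \<open>split_factor_swap\<close> makes it the first factor.\<close>

lemma apply_halving_inner:
  assumes swap: "\<And>v. swap_vec (V *v v) = V *v v"
    and Q: "Q \<in> dyadic_partitions" "dyadic k a \<in> Q"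
    and \<phi>: "\<phi> \<in> tensor_space Q" and \<psi>: "\<psi> \<in> tensor_space Q"
    and J: "J = dyadic (Suc k) (2 * a) \<or> J = dyadic (Suc k) (2 * a + 1)"
  shows "tensor_inner (halve Q k a) (apply_halving V k a \<phi>) (apply_at J A (apply_halving V k a \<psi>)) =
    tensor_inner Q \<phi> (apply_at (dyadic k a) (E_map V A) \<psi>)"
proof -
  let ?I = "dyadic k a" and ?L = "dyadic (Suc k) (2 * a)" and ?R = "dyadic (Suc k) (2 * a + 1)"
  define S where "S = Q - {?I}"
  have QS: "Q = insert ?I S" "?I \<notin> S" "finite S"
    using Q by (auto simp: S_def dyadic_partitions_def)
  have ne: "?L \<notin> insert ?I S" "?R \<notin> insert ?I S" "?L \<noteq> ?R"
    using half_not_mem[OF Q] unfolding QS(1)[symmetric] by (simp_all add: dyadic_eq_iff)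
  have h: "halve Q k a = insert ?L (insert ?R S)" "halve Q k a = insert ?R (insert ?L S)"
    by (auto simp: halve_def S_def)
  have H: "apply_halving V k a = split_factor V ?I ?L ?R" "apply_halving V k a = split_factor V ?I ?R ?L"
    unfolding apply_halving_eq_split_factor by (rule refl split_factor_swap[OF swap])+
  note \<phi>\<psi> = \<phi>[unfolded QS(1)] \<psi>[unfolded QS(1)]
  from J show ?thesis
  proof
    assume J: "J = ?L"
    show ?thesis
      using split_factor_inner[OF QS(3,2) ne \<phi>\<psi>, of V A]
      unfolding h(1) H(1) J QS(1)[symmetric] .
  next
    assume J: "J = ?R"
    show ?thesis
      using split_factor_inner[OF QS(3,2) ne(2,1) ne(3)[symmetric] \<phi>\<psi>, of V A]
      unfolding h(2) H(2) J QS(1)[symmetric] .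
  qed
qed

section \<open>Single fields under one halving\<close>

text \<open>Only one interval of \<open>Q\<close> contains \<open>z\<close>, so one summand
  survives. Its scalar is absorbed into the matrix, giving a local operator to which
  \<open>apply_halving_inner\<close> applies.\<close>

lemma field_op_eq:
  assumes Q: "Q \<in> dyadic_partitions" "dyadic k a \<in> Q" and z: "z \<in> dyadic k a"
  shows "field_op lam mu Q \<alpha> z = apply_at (dyadic k a) (mat_scale (lam \<alpha> powi (- int k)) (mu \<alpha>))"
proof (intro ext)
  fix \<psi> :: "'a state" and s
  have fin: "finite Q" using Q by (simp add: dyadic_partitions_def)
  have "log 2 (1 / 2 ^ k :: real) = - real k" by (simp add: log_divide log_nat_power)
  then have fl: "\<lfloor>log 2 (measure lborel (dyadic k a))\<rfloor> = - int k"
    by (simp add: measure_dyadic) (metis floor_of_int of_int_minus of_int_of_nat_eq)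
  have "indicator I z = (0 :: complex)" if "I \<in> Q - {dyadic k a}" for I
    using partD[OF Q(1) _ Q(2) _ z] that by (auto simp: indicator_def)
  then have "field_op lam mu Q \<alpha> z \<psi> s = lam \<alpha> powi (- int k) * apply_at (dyadic k a) (mu \<alpha>) \<psi> s"
    unfolding field_op_def by (subst sum.remove[OF fin Q(2)]) (simp add: z fl)
  then show "field_op lam mu Q \<alpha> z \<psi> s =
      apply_at (dyadic k a) (mat_scale (lam \<alpha> powi (- int k)) (mu \<alpha>)) \<psi> s"
    by (simp add: apply_at_def mat_scale_def sum_distrib_left mult.assoc)
qed

lemma dyadic_partition_cover:
  assumes "Q \<in> dyadic_partitions" "z \<in> {0..<1}"
  obtains k a where "dyadic k a \<in> Q" "z \<in> dyadic k a"
proof -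
  have "z \<in> \<Union>Q" using assms by (simp add: dyadic_partitions_def partition_on_def)
  then obtain I where "I \<in> Q" "z \<in> I" by blast
  then show ?thesis using assms(1) that by (auto simp: dyadic_partitions_def)
qed

lemma field_op_tensor_space:
  assumes "Q \<in> dyadic_partitions" "z \<in> {0..<1}" "\<psi> \<in> tensor_space Q"
  shows "field_op lam mu Q \<alpha> z \<psi> \<in> tensor_space Q"
proof -
  obtain k a where "dyadic k a \<in> Q" "z \<in> dyadic k a"
    using dyadic_partition_cover assms(1,2) by blast
  then show ?thesis by (simp add: field_op_eq[OF assms(1)] apply_at_tensor_space assms(3))
qed

text \<open>Since \<open>y\<close> lies outside \<open>I\<close>, the two fields act on different
  tensor factors.\<close>

lemma field_op_commute:
  assumes Q: "Q \<in> dyadic_partitions" and I: "I \<in> Q" "z \<in> I" "y \<notin> I" and y: "y \<in> {0..<1}"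
  shows "field_op lam mu Q \<alpha> z (field_op lam mu Q \<beta> y \<psi>) =
    field_op lam mu Q \<beta> y (field_op lam mu Q \<alpha> z \<psi>)"
proof -
  obtain l b where J: "dyadic l b \<in> Q" "y \<in> dyadic l b"
    using dyadic_partition_cover Q y by blast
  obtain k a where I': "I = dyadic k a" using Q I(1) by (auto simp: dyadic_partitions_def)
  have "dyadic k a \<noteq> dyadic l b" using J(2) I(3) I' by blast
  then show ?thesis
    unfolding field_op_eq[OF Q J] field_op_eq[OF Q I(1,2)[unfolded I']] by (rule apply_at_commute)
qed

text \<open>The interval containing \<open>y\<close> survives the halving, so the field is the same
  local operator before and after, and \<open>V\<close> acts on another factor.\<close>

lemma field_op_halve_outside:
  assumes Q: "Q \<in> dyadic_partitions" "dyadic k a \<in> Q" and y: "y \<in> {0..<1}" "y \<notin> dyadic k a"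
  shows "field_op lam mu (halve Q k a) \<beta> y (apply_halving V k a \<psi>) =
    apply_halving V k a (field_op lam mu Q \<beta> y \<psi>)"
proof -
  obtain l b where J: "dyadic l b \<in> Q" "y \<in> dyadic l b"
    using dyadic_partition_cover Q y by blast
  have ne: "dyadic l b \<noteq> dyadic k a" using J(2) y(2) by blast
  then have J': "dyadic l b \<in> halve Q k a" using J by (simp add: halve_def)
  have "dyadic l b \<noteq> dyadic (Suc k) (2 * a)" "dyadic l b \<noteq> dyadic (Suc k) (2 * a + 1)"
    using half_not_mem[OF Q] J(1) by metis+
  then show ?thesis
    unfolding field_op_eq[OF Q(1) J] field_op_eq[OF halve_dyadic_partition(1)[OF Q] J' J(2)]
      apply_halving_eq_split_factor
    by (rule apply_at_split_factor[OF ne])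
qed

lemma field_op_halve_inside:
  assumes swap: "\<And>v. swap_vec (V *v v) = V *v v"
    and eig: "E_map V (mu \<alpha>) = mat_scale (lam \<alpha>) (mu \<alpha>)" and nz: "lam \<alpha> \<noteq> 0"
    and Q: "Q \<in> dyadic_partitions" "dyadic k a \<in> Q" and z: "z \<in> dyadic k a"
    and \<phi>: "\<phi> \<in> tensor_space Q" and \<psi>: "\<psi> \<in> tensor_space Q"
  shows "tensor_inner (halve Q k a) (apply_halving V k a \<phi>)
      (field_op lam mu (halve Q k a) \<alpha> z (apply_halving V k a \<psi>)) =
    tensor_inner Q \<phi> (field_op lam mu Q \<alpha> z \<psi>)"
proof -
  obtain b where b: "b = 2 * a \<or> b = 2 * a + 1" "z \<in> dyadic (Suc k) b"
    using z dyadic_Un[of k a] by auto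
  have mem: "dyadic (Suc k) b \<in> halve Q k a" using b(1) by (auto simp: halve_def)
  \<comment> \<open>Halving the interval lowers the exponent by one, and the eigenvalue of
    \<open>E_map\<close> makes up for it. A nonzero eigenvalue is required for this law with
    negative exponents.\<close>
  have "lam \<alpha> powi (- int (Suc k)) * lam \<alpha> = lam \<alpha> powi (- int k)"
    using power_int_add_1[of "lam \<alpha>" "- int (Suc k)"] nz by simp
  then have E: "E_map V (mat_scale (lam \<alpha> powi (- int (Suc k))) (mu \<alpha>)) =
      mat_scale (lam \<alpha> powi (- int k)) (mu \<alpha>)"
    unfolding E_map_mat_scale eig by (simp add: mat_scale_def vec_eq_iff flip: mult.assoc)
  have J: "dyadic (Suc k) b = dyadic (Suc k) (2 * a) \<or> dyadic (Suc k) b = dyadic (Suc k) (2 * a + 1)"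
    using b(1) by auto
  show ?thesis
    unfolding field_op_eq[OF Q z] field_op_eq[OF halve_dyadic_partition(1)[OF Q] mem b(2)]
      apply_halving_inner[OF swap Q \<phi> \<psi> J] E ..
qed

section \<open>Products of fields under one halving\<close>

text \<open>This is \<open>M_op\<close> on a single list of pairs, which can be split at the one
  field lying in the halved interval.\<close>

definition field_prod ::
  "(nat \<Rightarrow> complex) \<Rightarrow> (nat \<Rightarrow> complex ^ 'n ^ 'n) \<Rightarrow> real set set \<Rightarrow> (nat \<times> real) list \<Rightarrow>
   'n::finite state \<Rightarrow> 'n state" where
  "field_prod lam mu Q ps = foldr (\<lambda>(\<alpha>, x) A. field_op lam mu Q \<alpha> x \<circ> A) ps id"

lemma field_prod_Nil [simp]: "field_prod lam mu Q [] \<psi> = \<psi>"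
  and field_prod_Cons [simp]:
    "field_prod lam mu Q ((\<alpha>, x) # ps) \<psi> = field_op lam mu Q \<alpha> x (field_prod lam mu Q ps \<psi>)"
  by (simp_all add: field_prod_def)

lemma field_prod_append [simp]:
  "field_prod lam mu Q (ps @ qs) \<psi> = field_prod lam mu Q ps (field_prod lam mu Q qs \<psi>)"
  by (induction ps) auto

lemma field_prod_tensor_space:
  assumes "Q \<in> dyadic_partitions" "snd ` set ps \<subseteq> {0..<1}" "\<psi> \<in> tensor_space Q"
  shows "field_prod lam mu Q ps \<psi> \<in> tensor_space Q"
  using assms(2) by (induction ps) (auto simp: assms field_op_tensor_space)

lemma field_prod_commute:
  assumes "Q \<in> dyadic_partitions" "I \<in> Q" "z \<in> I" "snd ` set ps \<subseteq> {0..<1} - I"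
  shows "field_prod lam mu Q ps (field_op lam mu Q \<alpha> z \<psi>) =
    field_op lam mu Q \<alpha> z (field_prod lam mu Q ps \<psi>)"
  using assms(4) by (induction ps) (auto simp: field_op_commute[OF assms(1-3)])

lemma field_prod_halve_outside:
  assumes "Q \<in> dyadic_partitions" "dyadic k a \<in> Q" "snd ` set ps \<subseteq> {0..<1} - dyadic k a"
  shows "field_prod lam mu (halve Q k a) ps (apply_halving V k a \<psi>) =
    apply_halving V k a (field_prod lam mu Q ps \<psi>)"
  using assms(3) by (induction ps) (auto simp: field_op_halve_outside[OF assms(1,2)])

text \<open>Fields outside the halved interval pass through \<open>V\<close> and can be absorbed
  into the right-hand vector. What remains is an inner product with at most one field in that
  interval.\<close>

lemma field_prod_halve_inner:
  fixes V :: "complex ^ 'n::finite ^ ('n \<times> 'n)"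
  assumes swap: "\<And>v. swap_vec (V *v v) = V *v v" and unital: "E_map V (mat 1) = mat 1"
    and eig: "\<And>p. p \<in> set ps \<Longrightarrow>
      E_map V (mu (fst p)) = mat_scale (lam (fst p)) (mu (fst p)) \<and> lam (fst p) \<noteq> 0"
    and Q: "Q \<in> dyadic_partitions" "dyadic k a \<in> Q"
    and range: "snd ` set ps \<subseteq> {0..<1}"
    and one: "card {j. j < length ps \<and> snd (ps ! j) \<in> dyadic k a} \<le> 1"
    and \<phi>: "\<phi> \<in> tensor_space Q" and \<psi>: "\<psi> \<in> tensor_space Q"
  shows "tensor_inner (halve Q k a) (apply_halving V k a \<phi>)
      (field_prod lam mu (halve Q k a) ps (apply_halving V k a \<psi>)) =
    tensor_inner Q \<phi> (field_prod lam mu Q ps \<psi>)"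
proof (cases "\<exists>j<length ps. snd (ps ! j) \<in> dyadic k a")
  \<comment> \<open>All fields pass through the halving, which preserves the inner product: this is
    \<open>apply_halving_inner\<close> for the identity matrix, by \<open>unital\<close>.\<close>
  case False
  then have "snd ` set ps \<subseteq> {0..<1} - dyadic k a"
    using range by (auto simp: in_set_conv_nth) (metis snd_conv)
  note out = field_prod_halve_outside[OF Q this]
  have "tensor_inner (halve Q k a) (apply_halving V k a \<phi>) (apply_halving V k a \<xi>) =
      tensor_inner Q \<phi> \<xi>" if "\<xi> \<in> tensor_space Q" for \<xi>
    using apply_halving_inner[OF swap Q \<phi> that disjI1[OF refl], of "mat 1"] unfolding unital by simp
  then show ?thesis unfolding out using field_prod_tensor_space[OF Q(1) range \<psi>] by blast
next
  case True
  then obtain j where j: "j < length ps" "snd (ps ! j) \<in> dyadic k a" by blast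
  obtain \<alpha> z where p: "ps ! j = (\<alpha>, z)" by (cases "ps ! j")
  define ys zs where "ys = take j ps" and "zs = drop (Suc j) ps"
  have ps: "ps = ys @ (\<alpha>, z) # zs" unfolding ys_def zs_def p[symmetric]
    by (rule id_take_nth_drop[OF j(1)])
  have uniq: "i = j" if "i < length ps" "snd (ps ! i) \<in> dyadic k a" for i
    using one that j by (auto simp: card_le_Suc0_iff_eq)
  have ys: "snd ` set ys \<subseteq> {0..<1} - dyadic k a"
  proof -
    have "snd p \<notin> dyadic k a" if p: "p \<in> set ys" for p
    proof -
      obtain i where "i < j" "ps ! i = p"
        using p unfolding ys_def in_set_conv_nth by auto
      then show ?thesis using uniq[of i] j(1) by auto
    qed
    then show ?thesis using range unfolding ps by auto
  qed
  have zs: "snd ` set zs \<subseteq> {0..<1} - dyadic k a"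
  proof -
    have "snd p \<notin> dyadic k a" if p: "p \<in> set zs" for p
    proof -
      obtain i where i: "i < length zs" "zs ! i = p" using p unfolding in_set_conv_nth by blast
      have "Suc j + i < length ps" using i(1) by (simp add: zs_def)
      then show ?thesis using uniq[of "Suc j + i"] i(2) by (auto simp: zs_def)
    qed
    then show ?thesis using range unfolding ps by auto
  qed
  have z: "z \<in> dyadic k a" using j p by simp
  have eig: "E_map V (mu \<alpha>) = mat_scale (lam \<alpha>) (mu \<alpha>)" "lam \<alpha> \<noteq> 0"
    using eig[of "(\<alpha>, z)"] ps by auto
  have Q': "halve Q k a \<in> dyadic_partitions" using halve_dyadic_partition(1)[OF Q] .
  obtain b where b: "z \<in> dyadic (Suc k) b" "dyadic (Suc k) b \<in> halve Q k a"
      "dyadic (Suc k) b \<subseteq> dyadic k a"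
    using z dyadic_Un[of k a] by (auto simp: halve_def)
  have ys': "snd ` set ys \<subseteq> {0..<1} - dyadic (Suc k) b" using ys b(3) by blast
  \<comment> \<open>This vector, carrying every field except the one at \<open>z\<close>, takes the
    place of \<open>\<psi>\<close> in \<open>field_op_halve_inside\<close>.\<close>
  have "field_prod lam mu Q (ys @ zs) \<psi> \<in> tensor_space Q"
    using ys zs by (intro field_prod_tensor_space[OF Q(1) _ \<psi>]) auto
  note inside = field_op_halve_inside[where lam = lam and mu = mu, OF swap eig Q z \<phi> this]
  \<comment> \<open>The fields \<open>zs\<close> pass through the halving, the field at
    \<open>z\<close> moves to the front past \<open>ys\<close> on both sides, and then
    \<open>ys\<close> passes through as well.\<close>
  show ?thesis
    using inside
    unfolding ps field_prod_append field_prod_Cons field_prod_halve_outside[OF Q zs]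
      field_prod_commute[OF Q' b(2,1) ys'] field_prod_commute[OF Q z ys]
      field_prod_halve_outside[OF Q ys] .
qed

section \<open>Supporting partitions and the vacuum under halvings\<close>

text \<open>Every interval of the new partition lies in an old one, so the counts cannot grow. This
  keeps the hypothesis alive along a sequence of halvings.\<close>

lemma supports_halve:
  assumes "supports Q xs" "dyadic k a \<in> Q"
  shows "supports (halve Q k a) xs"
proof -
  have "card {j. j < length xs \<and> xs ! j \<in> J} \<le> 1" if J: "J \<in> halve Q k a" for J
  proof -
    obtain I where I: "I \<in> Q" "J \<subseteq> I"
      using J assms(2) dyadic_halves_subset[of k a] unfolding halve_def by blast
    have "card {j. j < length xs \<and> xs ! j \<in> J} \<le> card {j. j < length xs \<and> xs ! j \<in> I}"
      using I(2) by (intro card_mono) auto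
    also have "\<dots> \<le> 1" using assms(1) I(1) by (simp add: supports_def)
    finally show ?thesis .
  qed
  then show ?thesis by (simp add: supports_def)
qed

lemma dyadic_0_0: "dyadic 0 0 = {0..<1}"
  by (simp add: dyadic_def)

lemma trivial_dyadic_partition: "{{0..<1}} \<in> dyadic_partitions"
  by (auto simp: dyadic_partitions_def partition_on_def dyadic_0_0[symmetric] dyadic_nonempty[symmetric])

lemma refines_trivial:
  assumes "Q \<in> dyadic_partitions"
  shows "refines {0..<1} Q {{0..<1}}"
  using assms trivial_dyadic_partition by (auto simp: dyadic_partitions_def refines_def partition_on_def)

text \<open>\<open>halving_map.step\<close> adds a halving at the coarse end only, whereas the
  vacuum must be followed through a halving at the fine end.\<close>

lemma halving_map_trans:
  assumes "halving_map V P Q \<Phi>" "halving_map V Q R \<Psi>"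
  shows "halving_map V P R (\<Psi> \<circ> \<Phi>)"
  using assms
proof induction
  case (step k a P Q \<Phi>)
  then have "halving_map V (halve P k a) R (\<Psi> \<circ> \<Phi>)" by blast
  from halving_map.step[OF step.hyps(1) this] show ?case by (simp only: comp_assoc)
qed simp

lemma vacuum_tensor_space:
  assumes "Q \<in> dyadic_partitions"
  shows "vacuum V \<omega> Q \<in> tensor_space Q"
  unfolding vacuum_def
  using halving_map_refine_map[OF trivial_dyadic_partition assms refines_trivial[OF assms]]
  by (rule halving_map_tensor_space) (simp add: tensor_space_def)

text \<open>Halving \<open>Q\<close> after reaching it from the trivial partition is one way of
  reaching \<open>halve Q k a\<close>, and by \<open>halving_map_unique\<close> every way gives the
  same map.\<close>

lemma vacuum_halve:
  assumes Q: "Q \<in> dyadic_partitions" "dyadic k a \<in> Q"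
  shows "vacuum V \<omega> (halve Q k a) = apply_halving V k a (vacuum V \<omega> Q)"
proof -
  note Q' = halve_dyadic_partition(1)[OF Q]
  have "halving_map V Q (halve Q k a) (id \<circ> apply_halving V k a)"
    using Q(2) halving_map.none by (rule halving_map.step)
  from halving_map_trans[OF halving_map_refine_map[OF trivial_dyadic_partition Q(1)
        refines_trivial[OF Q(1)]] this]
  have "halving_map V {{0..<1}} (halve Q k a) (apply_halving V k a \<circ> refine_map V {{0..<1}} Q)"
    by simp
  from halving_map_unique[OF halving_map_refine_map[OF trivial_dyadic_partition Q'
        refines_trivial[OF Q']] this trivial_dyadic_partition]
  show ?thesis by (simp add: vacuum_def)
qed

section \<open>Constancy of the net of correlation functions\<close>

theorem theorem6p13:
  fixes V :: "complex ^ 'n::finite ^ ('n \<times> 'n)"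
    and lam :: "nat \<Rightarrow> complex"
    and mu :: "nat \<Rightarrow> complex ^ 'n ^ 'n"
    and \<omega> :: "complex ^ 'n"
    and xs :: "real list"
    and \<alpha>s :: "nat list"
    and P :: "real set set"
  assumes "isometry_mat V"
    and "\<And>v. swap_vec (V *v v) = V *v v"
    and "eigenbasis V lam mu"
    and "mu 0 = mat 1"
    and "lam 0 = 1"
    and "\<And>\<alpha>. \<alpha> < CARD('n)\<^sup>2 \<Longrightarrow> lam \<alpha> \<noteq> 0"
    and "norm \<omega> = 1"
    and "sorted_wrt (<) xs"
    and "set xs \<subseteq> {0..<1}"
    and "length \<alpha>s = length xs"
    and "set \<alpha>s \<subseteq> {..<CARD('n)\<^sup>2}"
    and "minimal_supporting P xs"
  shows "((\<lambda>Q. tensor_inner Q (vacuum V \<omega> Q) (M_op lam mu Q \<alpha>s xs (vacuum V \<omega> Q)))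
            \<longlongrightarrow> tensor_inner P (vacuum V \<omega> P) (M_op lam mu P \<alpha>s xs (vacuum V \<omega> P)))
           (refinement_net P)"
proof -
  have swap: "swap_vec (V *v v) = V *v v" for v by (rule assms(2))
  have eig: "E_map V (mu \<alpha>) = mat_scale (lam \<alpha>) (mu \<alpha>)" if "\<alpha> < CARD('n)\<^sup>2" for \<alpha>
    using assms(3) that by (simp add: eigenbasis_def)
  \<comment> \<open>The eigenvalue equation at index 0, where the eigenvector is the identity and
    the eigenvalue is 1.\<close>
  have unital: "E_map V (mat 1) = mat 1"
    using eig[of 0] assms(4,5) by (simp add: mat_scale_def vec_eq_iff)
  let ?ps = "zip \<alpha>s xs"
  have M: "M_op lam mu Q \<alpha>s xs = field_prod lam mu Q ?ps" for Q
    by (simp add: M_op_def field_prod_def)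
  have ps: "fst p < CARD('n)\<^sup>2" if "p \<in> set ?ps" for p
    using that assms(11) set_zip_leftD[of "fst p" "snd p"] by auto
  have range: "snd ` set ?ps \<subseteq> {0..<1}"
    using assms(9) by (auto dest: set_zip_rightD)
  let ?F = "\<lambda>Q. tensor_inner Q (vacuum V \<omega> Q) (M_op lam mu Q \<alpha>s xs (vacuum V \<omega> Q))"
  \<comment> \<open>Stated for every supporting \<open>R\<close> rather than for \<open>P\<close>,
    because the induction hypothesis is needed at \<open>halve R k a\<close>, which supports
    \<open>xs\<close> but need not be minimal.\<close>
  have const: "?F Q = ?F R" if "halving_map V R Q \<Phi>" "R \<in> dyadic_partitions" "supports R xs" for R Q \<Phi>
    using that
  proof induction
    case (step k a R Q \<Phi>)
    have one: "card {j. j < length ?ps \<and> snd (?ps ! j) \<in> dyadic k a} \<le> 1"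
      using step.prems(2) step.hyps(1) assms(10) by (simp add: supports_def cong: conj_cong)
    note v = vacuum_tensor_space[OF step.prems(1)]
    have "?F (halve R k a) = ?F R"
      unfolding vacuum_halve[OF step.prems(1) step.hyps(1)] M
      by (rule field_prod_halve_inner[OF swap unital _ step.prems(1) step.hyps(1) range one v v])
        (use ps eig assms(6) in blast)
    moreover have "?F Q = ?F (halve R k a)"
      using step.IH halve_dyadic_partition(1)[OF step.prems(1) step.hyps(1)]
        supports_halve[OF step.prems(2) step.hyps(1)] by simp
    ultimately show ?case by simp
  qed simp
  have P: "P \<in> dyadic_partitions" "supports P xs"
    using assms(12) by (simp_all add: minimal_supporting_def)
  have "eventually (\<lambda>Q. ?F Q = ?F P) (refinement_net P)"
    unfolding eventually_refinement_net[OF P(1)]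
  \<comment> \<open>The tail may start at \<open>P\<close> itself, since the equality holds on the
    whole index set of the net.\<close>
  proof (intro bexI[of _ P] conjI ballI impI)
    show "refines {0..<1} P P"
      using P(1) by (intro refines_refl) (simp add: dyadic_partitions_def)
    fix Q assume "Q \<in> dyadic_partitions" "refines {0..<1} Q P"
    then show "?F Q = ?F P"
      using halving_map_refine_map[OF P(1)] const P by blast
  qed (rule P(1))
  then show ?thesis by (rule tendsto_eventually)
qed

end
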